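(* Let $(\mathcal{P},\leq,\Omega)$ be a poset with a flow. The generalized Gromov-Hausdorff distance $d_{\mathrm{GH}}$ on the collection of all $\mathcal{P}$-indexed simplicial filtrations over nonempty finite sets is geodesic.
   Context: All vertex sets $X,Y,Z$ are nonempty and finite. A (strict) flow on a poset $\mathcal{P}$ is a family $\Omega=\{\Omega_\varepsilon:\mathcal{P}\to\mathcal{P}\}_{\varepsilon\in[0,\infty)}$ of order-preserving maps such that $\Omega_s\leq\Omega_t$ pointwise for $s\leq t$, $\Omega_t\Omega_s=\Omega_{t+s}$, and $\Omega_0=\mathrm{id}_{\mathcal{P}}$. $\mathbf{Simp}(X)$ is the set of abstract simplicial complexes over a vertex set $A\subset X$ (including the empty complex), ordered by inclusion. A $\mathcal{P}$-indexed simplicial filtration over $X$ is an order-preserving map $\mathcal{P}\to\mathbf{Simp}(X)$. $d_{\mathrm{I}}^{\mathbf{Simp}(X)}(\mathbf{F},\mathbf{G})$ is the infimum of all $\varepsilon\in[0,\infty)$ such that $\mathbf{F}(p)\subset\mathbf{G}(\Omega_\varepsilon(p))$ and $\mathbf{G}(p)\subset\mathbf{F}(\Omega_\varepsilon(p))$ for all $p\in\mathcal{P}$ ($\infty$ if there is none). For a surjection $\varphi_X:Z\twoheadrightarrow X$ and a filtration $\mathbf{F}_X:\mathcal{P}\to\mathbf{Simp}(X)$, the pullback $\varphi_X^\ast\mathbf{F}_X:\mathcal{P}\to\mathbf{Simp}(Z)$ sends $p$ to the smallest simplicial complex in $\mathbf{Simp}(Z)$ containing all preimages $\varphi_X^{-1}(\tau)$,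 $\tau\in\mathbf{F}_X(p)$. A tripod between $X$ and $Y$ is a pair of surjections $R: X\twoheadleftarrow Z\twoheadrightarrow Y$, denoted $\varphi_X:Z\to X$ and $\varphi_Y:Z\to Y$. The generalized Gromov-Hausdorff distance is $d_{\mathrm{GH}}(\mathbf{F}_X,\mathbf{G}_Y):=\frac12\min_R d_{\mathrm{I}}^{\mathbf{Simp}(Z)}(\varphi_X^\ast\mathbf{F}_X,\varphi_Y^\ast\mathbf{G}_Y)$, the minimum being over all tripods between $X$ and $Y$; it is an extended pseudometric. Geodesicity convention: for an extended pseudometric space $(M,d)$, a point $x$ is identified with its class $\{y:d(x,y)=0\}$. For $x,y\in M$ with $d(x,y)<\infty$, a path from $x$ to $y$ is a continuous map $g:[0,1]\to M$ with $g(0)=x$ and $g(1)=y$ (up to this identification, i.e. $d(g(0),x)=0=d(g(1),y)$). The path is geodesic if $d(g(s),g(t))=|s-t|\cdot d(x,y)$ for all $s,t\in[0,1]$. $(M,d)$ (or $d$) is geodesic if every pair of points at finite distance is joined by a geodesic path. *)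

theory Defs
  imports "HOL-Library.Extended_Nonnegative_Real"
begin

text \<open>The poset is a type of class \<open>order\<close>. A flow is a function on \<open>real\<close> of which only the
  values at nonnegative arguments matter.\<close>

definition flow :: "(real \<Rightarrow> 'p::order \<Rightarrow> 'p) \<Rightarrow> bool" where
  "flow \<Omega> \<longleftrightarrow>
     (\<forall>\<epsilon>\<ge>0. mono (\<Omega> \<epsilon>)) \<and>
     (\<forall>s t. 0 \<le> s \<and> s \<le> t \<longrightarrow> (\<forall>p. \<Omega> s p \<le> \<Omega> t p)) \<and>
     (\<forall>s\<ge>0. \<forall>t\<ge>0. \<Omega> t \<circ> \<Omega> s = \<Omega> (t + s)) \<and>
     \<Omega> 0 = id"

text \<open>Simplices are nonempty. The empty complex \<open>{}\<close> is the one with vertex set \<open>{}\<close>.\<close>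

definition simplicial_complex :: "'v set \<Rightarrow> 'v set set \<Rightarrow> bool" where
  "simplicial_complex A K \<longleftrightarrow>
     (\<forall>\<sigma>\<in>K. \<sigma> \<noteq> {} \<and> finite \<sigma> \<and> \<sigma> \<subseteq> A) \<and>
     (\<forall>a\<in>A. {a} \<in> K) \<and>
     (\<forall>\<sigma>\<in>K. \<forall>\<tau>. \<tau> \<noteq> {} \<and> \<tau> \<subseteq> \<sigma> \<longrightarrow> \<tau> \<in> K)"

definition Simp :: "'v set \<Rightarrow> 'v set set set" where
  "Simp X = {K. \<exists>A\<subseteq>X. simplicial_complex A K}"

definition filtration :: "'v set \<Rightarrow> ('p::order \<Rightarrow> 'v set set) \<Rightarrow> bool" where
  "filtration X F \<longleftrightarrow> (\<forall>p. F p \<in> Simp X) \<and> mono F"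

text \<open>The infimum of the empty set is \<open>\<infinity>\<close> in \<open>ennreal\<close>.\<close>

definition d_I :: "(real \<Rightarrow> 'p \<Rightarrow> 'p) \<Rightarrow> ('p \<Rightarrow> 'v set set) \<Rightarrow> ('p \<Rightarrow> 'v set set) \<Rightarrow> ennreal" where
  "d_I \<Omega> F G =
     Inf (ennreal ` {\<epsilon>. 0 \<le> \<epsilon> \<and> (\<forall>p. F p \<subseteq> G (\<Omega> \<epsilon> p) \<and> G p \<subseteq> F (\<Omega> \<epsilon> p))})"

text \<open>The preimage of a simplex under a map \<open>Z \<rightarrow> X\<close> is taken within \<open>Z\<close>, because the map is
  represented by a total function. \<open>Simp Z\<close> is closed under nonempty intersections, so the hull
  is the smallest complex in \<open>Simp Z\<close> containing the preimages.\<close>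

definition pullback ::
  "'z set \<Rightarrow> ('z \<Rightarrow> 'v) \<Rightarrow> ('p \<Rightarrow> 'v set set) \<Rightarrow> 'p \<Rightarrow> 'z set set" where
  "pullback Z \<phi> F p = (\<lambda>K. K \<in> Simp Z) hull ((\<lambda>\<tau>. \<phi> -` \<tau> \<inter> Z) ` F p)"

definition tripod :: "'v set \<Rightarrow> 'v set \<Rightarrow> 'z set \<Rightarrow> ('z \<Rightarrow> 'v) \<Rightarrow> ('z \<Rightarrow> 'v) \<Rightarrow> bool" where
  "tripod X Y Z \<phi>X \<phi>Y \<longleftrightarrow> finite Z \<and> Z \<noteq> {} \<and> \<phi>X ` Z = X \<and> \<phi>Y ` Z = Y"

text \<open>The apex \<open>Z\<close> of a tripod is taken in the universe \<open>'v\<close> of the vertex sets. If \<open>'v\<close> is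
  infinite, it contains a copy of every finite set, so this is no restriction. The minimum over
  tripods is written as an infimum: it is attained when tripods exist, because up to the
  interleaving distance only the image of \<open>Z\<close> in \<open>X \<times> Y\<close> matters.\<close>

definition d_GH ::
  "(real \<Rightarrow> 'p \<Rightarrow> 'p) \<Rightarrow> 'v set \<times> ('p \<Rightarrow> 'v set set) \<Rightarrow> 'v set \<times> ('p \<Rightarrow> 'v set set) \<Rightarrow> ennreal" where
  "d_GH \<Omega> = (\<lambda>(X, F) (Y, G).
     Inf {d_I \<Omega> (pullback Z \<phi>X F) (pullback Z \<phi>Y G) | (Z :: 'v set) \<phi>X \<phi>Y. tripod X Y Z \<phi>X \<phi>Y} / 2)"

text \<open>A filtration is paired with its vertex set, which the filtration itself need not exhaust.\<close>

definition filtrations :: "('v set \<times> ('p::order \<Rightarrow> 'v set set)) set" where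
  "filtrations = {(X, F). finite X \<and> X \<noteq> {} \<and> filtration X F}"

text \<open>The following notions are meant for an extended pseudometric \<open>d\<close> on \<open>M\<close>. Points at distance
  0 are identified, so a path has to meet its end points only up to distance 0.\<close>

definition path_between ::
  "'m set \<Rightarrow> ('m \<Rightarrow> 'm \<Rightarrow> ennreal) \<Rightarrow> 'm \<Rightarrow> 'm \<Rightarrow> (real \<Rightarrow> 'm) \<Rightarrow> bool" where
  "path_between M d x y g \<longleftrightarrow>
     (\<forall>t\<in>{0..1}. g t \<in> M) \<and>
     (\<forall>s\<in>{0..1}. \<forall>\<epsilon>>0. \<exists>\<delta>>0. \<forall>t\<in>{0..1}. \<bar>t - s\<bar> < \<delta> \<longrightarrow> d (g s) (g t) < \<epsilon>) \<and>
     d (g 0) x = 0 \<and> d (g 1) y = 0"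

definition geodesic_path ::
  "'m set \<Rightarrow> ('m \<Rightarrow> 'm \<Rightarrow> ennreal) \<Rightarrow> 'm \<Rightarrow> 'm \<Rightarrow> (real \<Rightarrow> 'm) \<Rightarrow> bool" where
  "geodesic_path M d x y g \<longleftrightarrow>
     path_between M d x y g \<and>
     (\<forall>s\<in>{0..1}. \<forall>t\<in>{0..1}. d (g s) (g t) = ennreal \<bar>s - t\<bar> * d x y)"

definition geodesic :: "'m set \<Rightarrow> ('m \<Rightarrow> 'm \<Rightarrow> ennreal) \<Rightarrow> bool" where
  "geodesic M d \<longleftrightarrow> (\<forall>x\<in>M. \<forall>y\<in>M. d x y < \<infinity> \<longrightarrow> (\<exists>g. geodesic_path M d x y g))"

end

theory Submission
  imports Defs
begin

text \<open>Let \<open>r\<close> be twice the distance of two filtrations over \<open>X\<close> and \<open>Y\<close>. The pullbacks to a tripod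
  with apex \<open>Z\<close> matter only through the image of \<open>Z\<close> in \<open>X \<times> Y\<close>. This image is one of finitely
  many sets, so some tripod realizes \<open>r\<close> as the interleaving distance of the two pullbacks
  \<open>F\<close> and \<open>G\<close>, which are filtrations over the same set \<open>Z\<close> (lemma \<open>d_GH_attained\<close>).

  The geodesic stays over \<open>Z\<close>. At time \<open>t\<close> it is the smallest filtration \<open>H t\<close> with
  \<open>F p \<subseteq> H t (\<Omega> (t * r) p)\<close> and \<open>G p \<subseteq> H t (\<Omega> ((1 - t) * r) p)\<close> for all \<open>p\<close>, that is, a union of
  members of \<open>F\<close> and \<open>G\<close> that enter late. From this formula alone, \<open>H s\<close> and \<open>H t\<close> are
  \<open>\<bar>s - t\<bar> * r\<close>-interleaved, and the identity tripod on \<open>Z\<close> bounds their distance from above.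

  The infimum that defines the interleaving distance need not be attained: \<open>F\<close> and \<open>G\<close>
  are \<open>\<epsilon>\<close>-interleaved for all \<open>\<epsilon> > r\<close>, perhaps not for \<open>\<epsilon> = r\<close>. Hence \<open>H 0\<close> may differ from \<open>F\<close>,
  but only by distance 0. More generally \<open>H t\<close> is \<open>\<epsilon>\<close>-interleaved with \<open>F\<close> for all \<open>\<epsilon> > t * r\<close>, and
  with \<open>G\<close> for all \<open>\<epsilon> > (1 - t) * r\<close>.

  For the lower bound, let a tripod with apex \<open>W\<close> give an \<open>\<epsilon>\<close>-interleaving of pullbacks of
  \<open>H s\<close> and \<open>H t\<close>, where \<open>s \<le> t\<close>. Both feet of the tripod are \<open>Z\<close>, so it extends to a tripod between
  \<open>X\<close> and \<open>Y\<close> by mere composition of maps, and there one passes from \<open>F\<close> to \<open>H s\<close>, to \<open>H t\<close>, to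
  \<open>G\<close>. This gives \<open>r \<le> s * r + \<epsilon> + (1 - t) * r\<close>, hence \<open>(t - s) * r \<le> \<epsilon>\<close>. The triangle inequality of
  the Gromov-Hausdorff distance, which would require fibre products of tripods, is thus
  avoided.\<close>

section \<open>Interleavings\<close>

definition interleaved ::
  "(real \<Rightarrow> 'p \<Rightarrow> 'p) \<Rightarrow> real \<Rightarrow> ('p \<Rightarrow> 'v set set) \<Rightarrow> ('p \<Rightarrow> 'v set set) \<Rightarrow> bool" where
  "interleaved \<Omega> \<epsilon> F G \<longleftrightarrow> (\<forall>p. F p \<subseteq> G (\<Omega> \<epsilon> p) \<and> G p \<subseteq> F (\<Omega> \<epsilon> p))"

lemma flow_mono: "flow \<Omega> \<Longrightarrow> 0 \<le> s \<Longrightarrow> p \<le> q \<Longrightarrow> \<Omega> s p \<le> \<Omega> s q"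
  by (auto simp: flow_def mono_def)

lemma flow_le: "flow \<Omega> \<Longrightarrow> 0 \<le> s \<Longrightarrow> s \<le> t \<Longrightarrow> \<Omega> s p \<le> \<Omega> t p"
  by (auto simp: flow_def)

lemma flow_add: "flow \<Omega> \<Longrightarrow> 0 \<le> s \<Longrightarrow> 0 \<le> t \<Longrightarrow> \<Omega> (t + s) p = \<Omega> t (\<Omega> s p)"
  unfolding flow_def by (metis comp_apply)

lemma flow_expand: "flow \<Omega> \<Longrightarrow> 0 \<le> t \<Longrightarrow> p \<le> \<Omega> t p"
  unfolding flow_def by (metis id_apply order_refl)

lemma interleaved_commute: "interleaved \<Omega> \<epsilon> F G \<longleftrightarrow> interleaved \<Omega> \<epsilon> G F"
  by (auto simp: interleaved_def)

lemma interleaved_trans: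
  assumes "flow \<Omega>" "0 \<le> \<epsilon>" "0 \<le> \<delta>" "interleaved \<Omega> \<epsilon> F G" "interleaved \<Omega> \<delta> G H"
  shows "interleaved \<Omega> (\<epsilon> + \<delta>) F H"
  unfolding interleaved_def
proof (intro allI conjI)
  fix p
  show "F p \<subseteq> H (\<Omega> (\<epsilon> + \<delta>) p)"
    using assms flow_add[of \<Omega> \<epsilon> \<delta> p] unfolding interleaved_def by (metis add.commute subset_trans)
  show "H p \<subseteq> F (\<Omega> (\<epsilon> + \<delta>) p)"
    using assms flow_add[of \<Omega> \<delta> \<epsilon> p] unfolding interleaved_def by (metis subset_trans)
qed

lemma interleaved_mono:
  assumes "flow \<Omega>" "0 \<le> \<epsilon>" "\<epsilon> \<le> \<delta>" "mono F" "mono G" "interleaved \<Omega> \<epsilon> F G"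
  shows "interleaved \<Omega> \<delta> F G"
proof -
  have "\<Omega> \<epsilon> p \<le> \<Omega> \<delta> p" for p
    using assms flow_le by blast
  then have "F (\<Omega> \<epsilon> p) \<subseteq> F (\<Omega> \<delta> p)" "G (\<Omega> \<epsilon> p) \<subseteq> G (\<Omega> \<delta> p)" for p
    using assms(4,5) by (simp_all add: monoD)
  then show ?thesis
    using assms(6) unfolding interleaved_def by (meson subset_trans)
qed

lemma d_I_interleaved: "d_I \<Omega> F G = Inf (ennreal ` {\<epsilon>. 0 \<le> \<epsilon> \<and> interleaved \<Omega> \<epsilon> F G})"
  by (simp add: d_I_def interleaved_def)

lemma d_I_commute: "d_I \<Omega> F G = d_I \<Omega> G F"
  by (simp add: d_I_interleaved interleaved_commute)

lemma d_I_le: "0 \<le> \<epsilon> \<Longrightarrow> interleaved \<Omega> \<epsilon> F G \<Longrightarrow> d_I \<Omega> F G \<le> ennreal \<epsilon>"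
  unfolding d_I_interleaved by (auto intro: Inf_lower)

lemma le_d_I:
  assumes "\<And>\<epsilon>. 0 \<le> \<epsilon> \<Longrightarrow> interleaved \<Omega> \<epsilon> F G \<Longrightarrow> c \<le> ennreal \<epsilon>"
  shows "c \<le> d_I \<Omega> F G"
  unfolding d_I_interleaved using assms by (auto intro: Inf_greatest)

lemma interleaved_if_d_I_less:
  assumes "flow \<Omega>" "mono F" "mono G" "d_I \<Omega> F G < ennreal \<delta>"
  shows "interleaved \<Omega> \<delta> F G"
proof -
  obtain \<epsilon> where "0 \<le> \<epsilon>" "interleaved \<Omega> \<epsilon> F G" "ennreal \<epsilon> < ennreal \<delta>"
    using assms(4) unfolding d_I_interleaved Inf_less_iff by blast
  moreover from this have "\<epsilon> \<le> \<delta>"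
    by (simp add: ennreal_less_iff)
  ultimately show ?thesis
    using assms interleaved_mono by blast
qed

lemma d_I_eq_0:
  assumes "\<And>\<delta>. 0 < \<delta> \<Longrightarrow> interleaved \<Omega> \<delta> F G"
  shows "d_I \<Omega> F G = 0"
proof -
  have "d_I \<Omega> F G \<le> 0"
    by (rule ennreal_le_epsilon) (auto intro!: d_I_le assms)
  then show ?thesis
    by simp
qed

section \<open>Pullbacks of filtrations\<close>

text \<open>A complex determines its vertex set, which is the union of its simplices.\<close>

lemma Simp_iff:
  "K \<in> Simp X \<longleftrightarrow>
     (\<forall>\<sigma>\<in>K. \<sigma> \<noteq> {} \<and> finite \<sigma> \<and> \<sigma> \<subseteq> X) \<and> (\<forall>\<sigma>\<in>K. \<forall>\<tau>. \<tau> \<noteq> {} \<and> \<tau> \<subseteq> \<sigma> \<longrightarrow> \<tau> \<in> K)"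
proof
  assume "K \<in> Simp X"
  then obtain A where "A \<subseteq> X" "simplicial_complex A K"
    unfolding Simp_def by blast
  then show "(\<forall>\<sigma>\<in>K. \<sigma> \<noteq> {} \<and> finite \<sigma> \<and> \<sigma> \<subseteq> X) \<and> (\<forall>\<sigma>\<in>K. \<forall>\<tau>. \<tau> \<noteq> {} \<and> \<tau> \<subseteq> \<sigma> \<longrightarrow> \<tau> \<in> K)"
    unfolding simplicial_complex_def by (meson subset_trans)
next
  assume K: "(\<forall>\<sigma>\<in>K. \<sigma> \<noteq> {} \<and> finite \<sigma> \<and> \<sigma> \<subseteq> X) \<and> (\<forall>\<sigma>\<in>K. \<forall>\<tau>. \<tau> \<noteq> {} \<and> \<tau> \<subseteq> \<sigma> \<longrightarrow> \<tau> \<in> K)"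
  have "{a} \<in> K" if "a \<in> \<Union>K" for a
    using K that by (metis UnionE empty_subsetI insert_not_empty insert_subset)
  then have "simplicial_complex (\<Union>K) K"
    unfolding simplicial_complex_def using K by blast
  moreover have "\<Union>K \<subseteq> X"
    using K by blast
  ultimately show "K \<in> Simp X"
    unfolding Simp_def by blast
qed

lemma Simp_face: "K \<in> Simp X \<Longrightarrow> \<sigma> \<in> K \<Longrightarrow> \<tau> \<noteq> {} \<Longrightarrow> \<tau> \<subseteq> \<sigma> \<Longrightarrow> \<tau> \<in> K"
  unfolding Simp_iff by blast

lemma Simp_preimage:
  assumes "K \<in> Simp X" "finite Z"
  shows "{\<sigma>. \<sigma> \<noteq> {} \<and> \<sigma> \<subseteq> Z \<and> \<phi> ` \<sigma> \<in> K} \<in> Simp Z"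
proof -
  have "\<phi> ` \<tau> \<in> K" if "\<phi> ` \<sigma> \<in> K" "\<tau> \<noteq> {}" "\<tau> \<subseteq> \<sigma>" for \<sigma> \<tau>
    using Simp_face[OF assms(1) that(1), of "\<phi> ` \<tau>"] that(2,3) by (simp add: image_mono)
  then show ?thesis
    unfolding Simp_iff using assms(2) by (auto intro: finite_subset)
qed

lemma Simp_Union: "(\<And>K. K \<in> \<K> \<Longrightarrow> K \<in> Simp X) \<Longrightarrow> \<Union>\<K> \<in> Simp X"
  unfolding Simp_iff by blast

text \<open>Every simplex \<open>\<sigma>\<close> with \<open>\<phi> ` \<sigma> \<in> F p\<close> is a face of the preimage of \<open>\<phi> ` \<sigma>\<close>, and these simplices
  form a complex already. Surjectivity makes \<open>\<tau>\<close> the image of its preimage, so that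
  the preimages of the simplices of \<open>F p\<close> belong to it.\<close>

lemma pullback_eq:
  assumes "F p \<in> Simp X" "finite Z" "\<phi> ` Z = X"
  shows "pullback Z \<phi> F p = {\<sigma>. \<sigma> \<noteq> {} \<and> \<sigma> \<subseteq> Z \<and> \<phi> ` \<sigma> \<in> F p}" (is "_ = ?K")
  unfolding pullback_def
proof (rule hull_unique)
  show "(\<lambda>\<tau>. \<phi> -` \<tau> \<inter> Z) ` F p \<subseteq> ?K"
  proof (rule image_subsetI)
    fix \<tau> assume \<tau>: "\<tau> \<in> F p"
    then have "\<tau> \<noteq> {}" "\<tau> \<subseteq> X"
      using assms(1) unfolding Simp_iff by auto
    then have "\<phi> ` (\<phi> -` \<tau> \<inter> Z) = \<tau>"
      using assms(3) by auto
    then show "\<phi> -` \<tau> \<inter> Z \<in> ?K"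
      using \<tau> \<open>\<tau> \<noteq> {}\<close> by auto
  qed
  show "?K \<in> Simp Z"
    using assms(1,2) by (rule Simp_preimage)
  show "?K \<subseteq> L" if "(\<lambda>\<tau>. \<phi> -` \<tau> \<inter> Z) ` F p \<subseteq> L" "L \<in> Simp Z" for L
  proof
    fix \<sigma> assume \<sigma>: "\<sigma> \<in> ?K"
    then have "\<phi> -` (\<phi> ` \<sigma>) \<inter> Z \<in> L" "\<sigma> \<subseteq> \<phi> -` (\<phi> ` \<sigma>) \<inter> Z" "\<sigma> \<noteq> {}"
      using that(1) by auto
    then show "\<sigma> \<in> L"
      using Simp_face[OF that(2)] by blast
  qed
qed

lemma pullback_filtration_eq:
  assumes "filtration X F" "finite Z" "\<phi> ` Z = X"
  shows "pullback Z \<phi> F p = {\<sigma>. \<sigma> \<noteq> {} \<and> \<sigma> \<subseteq> Z \<and> \<phi> ` \<sigma> \<in> F p}"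
  using assms by (intro pullback_eq) (simp_all add: filtration_def)

lemma filtration_pullback:
  assumes "filtration X F" "finite Z" "\<phi> ` Z = X"
  shows "filtration Z (pullback Z \<phi> F)"
proof -
  note eq = pullback_filtration_eq[OF assms]
  have "pullback Z \<phi> F p \<in> Simp Z" for p
    unfolding eq by (rule Simp_preimage) (use assms in \<open>auto simp: filtration_def\<close>)
  moreover have "mono (pullback Z \<phi> F)"
    using assms(1) unfolding filtration_def mono_def eq by blast
  ultimately show ?thesis
    by (simp add: filtration_def)
qed

lemma pullback_comp:
  assumes F: "filtration X F" and "finite Z" "\<phi> ` Z = X" and "finite W" "\<psi> ` W = Z"
  shows "pullback W \<psi> (pullback Z \<phi> F) = pullback W (\<phi> \<circ> \<psi>) F"
proof
  fix p
  note Z = pullback_filtration_eq[OF F assms(2,3)]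
  note WZ = pullback_filtration_eq[OF filtration_pullback[OF F assms(2,3)] assms(4,5)]
  have \<phi>\<psi>: "(\<phi> \<circ> \<psi>) ` W = X"
    using assms(3,5) by (metis image_comp)
  have "pullback W \<psi> (pullback Z \<phi> F) p = {\<sigma>. \<sigma> \<noteq> {} \<and> \<sigma> \<subseteq> W \<and> \<phi> ` \<psi> ` \<sigma> \<in> F p}"
    unfolding WZ Z using assms(5) by blast
  also have "\<dots> = pullback W (\<phi> \<circ> \<psi>) F p"
    unfolding pullback_filtration_eq[OF F assms(4) \<phi>\<psi>] by (simp add: image_comp)
  finally show "pullback W \<psi> (pullback Z \<phi> F) p = pullback W (\<phi> \<circ> \<psi>) F p" .
qed

lemma pullback_id:
  assumes "filtration Z F" "finite Z"
  shows "pullback Z id F = F"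
proof
  fix p
  have "\<sigma> \<noteq> {} \<and> \<sigma> \<subseteq> Z" if "\<sigma> \<in> F p" for \<sigma>
    using assms(1) that unfolding filtration_def Simp_iff by blast
  then have "{\<sigma>. \<sigma> \<noteq> {} \<and> \<sigma> \<subseteq> Z \<and> id ` \<sigma> \<in> F p} = F p"
    unfolding image_id id_apply by blast
  then show "pullback Z id F p = F p"
    using pullback_filtration_eq[OF assms, of id] by simp
qed

lemma interleaved_pullback:
  assumes "filtration X F" "filtration X G" "finite Z" "\<phi> ` Z = X" "interleaved \<Omega> \<epsilon> F G"
  shows "interleaved \<Omega> \<epsilon> (pullback Z \<phi> F) (pullback Z \<phi> G)"
proof -
  note eq = pullback_filtration_eq[OF assms(1,3,4)] pullback_filtration_eq[OF assms(2,3,4)]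
  show ?thesis
    using assms(5) unfolding interleaved_def eq by blast
qed

section \<open>Existence of optimal tripods\<close>

text \<open>The distance of two pullbacks expressed by the image \<open>E\<close> of the apex in the product of the
  vertex sets: a subset \<open>S\<close> of \<open>E\<close> stands for all simplices in the apex with image \<open>S\<close>.\<close>

definition correspondence_dist ::
  "(real \<Rightarrow> 'p \<Rightarrow> 'p) \<Rightarrow> ('p \<Rightarrow> 'v set set) \<Rightarrow> ('p \<Rightarrow> 'v set set) \<Rightarrow> ('v \<times> 'v) set \<Rightarrow> ennreal" where
  "correspondence_dist \<Omega> F G E =
     Inf (ennreal ` {\<epsilon>. 0 \<le> \<epsilon> \<and> (\<forall>p. \<forall>S\<subseteq>E. S \<noteq> {} \<longrightarrow>
       (fst ` S \<in> F p \<longrightarrow> snd ` S \<in> G (\<Omega> \<epsilon> p)) \<and> (snd ` S \<in> G p \<longrightarrow> fst ` S \<in> F (\<Omega> \<epsilon> p)))})"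

lemma d_I_pullback_eq_correspondence_dist:
  assumes F: "filtration X F" and G: "filtration Y G" and T: "tripod X Y Z \<phi> \<psi>"
  shows "d_I \<Omega> (pullback Z \<phi> F) (pullback Z \<psi> G) =
    correspondence_dist \<Omega> F G ((\<lambda>z. (\<phi> z, \<psi> z)) ` Z)"
proof -
  let ?\<rho> = "\<lambda>z. (\<phi> z, \<psi> z)"
  have Z: "finite Z" "\<phi> ` Z = X" "\<psi> ` Z = Y"
    using T by (auto simp: tripod_def)
  note eq = pullback_filtration_eq[OF F Z(1,2)] pullback_filtration_eq[OF G Z(1,3)]
  have "interleaved \<Omega> \<epsilon> (pullback Z \<phi> F) (pullback Z \<psi> G) \<longleftrightarrow>
      (\<forall>p. \<forall>S\<subseteq>?\<rho> ` Z. S \<noteq> {} \<longrightarrow>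
        (fst ` S \<in> F p \<longrightarrow> snd ` S \<in> G (\<Omega> \<epsilon> p)) \<and> (snd ` S \<in> G p \<longrightarrow> fst ` S \<in> F (\<Omega> \<epsilon> p)))"
    (is "_ \<longleftrightarrow> ?R") for \<epsilon>
  proof -
    have "?R \<longleftrightarrow> (\<forall>p. \<forall>\<sigma>\<subseteq>Z. \<sigma> \<noteq> {} \<longrightarrow>
        (\<phi> ` \<sigma> \<in> F p \<longrightarrow> \<psi> ` \<sigma> \<in> G (\<Omega> \<epsilon> p)) \<and> (\<psi> ` \<sigma> \<in> G p \<longrightarrow> \<phi> ` \<sigma> \<in> F (\<Omega> \<epsilon> p)))"
      by (simp add: all_subset_image image_image)
    then show ?thesis
      unfolding interleaved_def eq Collect_mono_iff
      by (simp add: all_conj_distrib imp_conjL imp_conjR conj_comms)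
  qed
  then show ?thesis
    unfolding d_I_interleaved correspondence_dist_def by simp
qed

lemma d_GH_le:
  fixes X Y Z :: "'v set"
  assumes "tripod X Y Z \<phi> \<psi>"
  shows "d_GH \<Omega> (X, F) (Y, G) \<le> d_I \<Omega> (pullback Z \<phi> F) (pullback Z \<psi> G) / 2"
  unfolding d_GH_def using assms by (auto 0 4 intro!: divide_right_mono_ennreal Inf_lower)

lemma le_d_GH:
  fixes X Y :: "'v set"
  assumes "\<And>(Z :: 'v set) \<phi> \<psi>. tripod X Y Z \<phi> \<psi> \<Longrightarrow> c \<le> d_I \<Omega> (pullback Z \<phi> F) (pullback Z \<psi> G)"
  shows "c / 2 \<le> d_GH \<Omega> (X, F) (Y, G)"
  unfolding d_GH_def using assms by (auto intro!: divide_right_mono_ennreal Inf_greatest)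

lemma tripod_commute: "tripod X Y Z \<phi> \<psi> \<longleftrightarrow> tripod Y X Z \<psi> \<phi>"
  by (auto simp: tripod_def)

lemma d_GH_commute: "d_GH \<Omega> (X, F) (Y, G) = d_GH \<Omega> (Y, G) (X, F)"
proof -
  define D where "D X F Y G =
    {d_I \<Omega> (pullback Z \<phi> F) (pullback Z \<psi> G) | (Z :: 'b set) \<phi> \<psi>. tripod X Y Z \<phi> \<psi>}"
    for X Y :: "'b set" and F G
  have "D X F Y G \<subseteq> D Y G X F" for X F Y G
    unfolding D_def by (subst d_I_commute, subst tripod_commute) blast
  then have "D X F Y G = D Y G X F"
    by blast
  then show ?thesis
    by (simp add: d_GH_def D_def)
qed

text \<open>The distances to be minimized are values of \<open>correspondence_dist\<close> on subsets of the finite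
  set \<open>X \<times> Y\<close>, hence finitely many. A finite distance also ensures that a tripod exists, as
  the infimum of the empty set is infinite.\<close>

lemma d_GH_attained:
  fixes X Y :: "'v set"
  assumes F: "filtration X F" "finite X" and G: "filtration Y G" "finite Y"
    and fin: "d_GH \<Omega> (X, F) (Y, G) < \<infinity>"
  obtains Z :: "'v set" and \<phi> \<psi> r where "tripod X Y Z \<phi> \<psi>" "0 \<le> r"
    "d_I \<Omega> (pullback Z \<phi> F) (pullback Z \<psi> G) = ennreal r"
    "d_GH \<Omega> (X, F) (Y, G) = ennreal r / 2"
proof -
  define D where
    "D = {d_I \<Omega> (pullback Z \<phi> F) (pullback Z \<psi> G) | (Z :: 'v set) \<phi> \<psi>. tripod X Y Z \<phi> \<psi>}"
  have d: "d_GH \<Omega> (X, F) (Y, G) = Inf D / 2"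
    by (simp add: d_GH_def D_def)
  have "D \<subseteq> correspondence_dist \<Omega> F G ` Pow (X \<times> Y)"
  proof
    fix c assume "c \<in> D"
    then obtain Z :: "'v set" and \<phi> \<psi> where T: "tripod X Y Z \<phi> \<psi>"
      and c: "c = d_I \<Omega> (pullback Z \<phi> F) (pullback Z \<psi> G)"
      by (auto simp: D_def)
    have "(\<lambda>z. (\<phi> z, \<psi> z)) ` Z \<in> Pow (X \<times> Y)"
      using T by (auto simp: tripod_def)
    then show "c \<in> correspondence_dist \<Omega> F G ` Pow (X \<times> Y)"
      using d_I_pullback_eq_correspondence_dist[OF F(1) G(1) T] c by blast
  qed
  then have "finite D"
    using F(2) G(2) by (meson finite_Pow_iff finite_SigmaI finite_imageI finite_subset)
  moreover have "Inf D \<noteq> \<infinity>"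
  proof
    assume "Inf D = \<infinity>"
    then show False
      using fin unfolding d by (simp only: infinity_ennreal_def ennreal_top_divide) simp
  qed
  moreover from this have "D \<noteq> {}"
    by auto
  ultimately have "Inf D \<in> D" "Inf D \<noteq> \<infinity>"
    using Min_in[of D] by (simp_all add: cInf_eq_Min)
  then obtain Z :: "'v set" and \<phi> \<psi> where T: "tripod X Y Z \<phi> \<psi>"
    and D: "d_I \<Omega> (pullback Z \<phi> F) (pullback Z \<psi> G) = Inf D"
    by (auto simp: D_def)
  obtain r where "0 \<le> r" "Inf D = ennreal r"
    using \<open>Inf D \<noteq> \<infinity>\<close> by (cases "Inf D") auto
  then show thesis
    using that[OF T] D d by simp
qed

section \<open>Interpolation of filtrations over a common vertex set\<close>

definition interpolation ::
  "(real \<Rightarrow> 'p::order \<Rightarrow> 'p) \<Rightarrow> real \<Rightarrow> ('p \<Rightarrow> 'v set set) \<Rightarrow> ('p \<Rightarrow> 'v set set) \<Rightarrow> real \<Rightarrow> 'p \<Rightarrow> 'v set set"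
  where "interpolation \<Omega> r F G t q =
    \<Union>({F p | p. \<Omega> (t * r) p \<le> q} \<union> {G p | p. \<Omega> ((1 - t) * r) p \<le> q})"

lemma interpolation_iff:
  "\<sigma> \<in> interpolation \<Omega> r F G t q \<longleftrightarrow>
     (\<exists>p. \<Omega> (t * r) p \<le> q \<and> \<sigma> \<in> F p) \<or> (\<exists>p. \<Omega> ((1 - t) * r) p \<le> q \<and> \<sigma> \<in> G p)"
  by (auto simp: interpolation_def)

lemma interpolation_swap: "interpolation \<Omega> r F G t = interpolation \<Omega> r G F (1 - t)"
  by (simp add: interpolation_def fun_eq_iff Un_commute)

lemma filtration_interpolation:
  assumes "filtration Z F" "filtration Z G"
  shows "filtration Z (interpolation \<Omega> r F G t)"
proof -
  have "interpolation \<Omega> r F G t q \<in> Simp Z" for q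
    unfolding interpolation_def by (rule Simp_Union) (use assms in \<open>auto simp: filtration_def\<close>)
  moreover have "mono (interpolation \<Omega> r F G t)"
  proof (intro monoI subsetI)
    fix p q \<sigma>
    assume "p \<le> q" "\<sigma> \<in> interpolation \<Omega> r F G t p"
    then show "\<sigma> \<in> interpolation \<Omega> r F G t q"
      unfolding interpolation_iff using order_trans[of _ p q] by blast
  qed
  ultimately show ?thesis
    by (simp add: filtration_def)
qed

text \<open>Between the times \<open>s \<le> t\<close> the members of \<open>F\<close> are delayed by \<open>(t - s) * r\<close> and those of \<open>G\<close>
  are advanced by the same amount.\<close>

lemma interleaved_interpolation:
  assumes \<Omega>: "flow \<Omega>" and "0 \<le> r" "0 \<le> s" "s \<le> t" "t \<le> 1"
  shows "interleaved \<Omega> ((t - s) * r) (interpolation \<Omega> r F G s) (interpolation \<Omega> r F G t)"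
proof -
  have le: "0 \<le> s * r" "0 \<le> t * r" "0 \<le> (t - s) * r" "0 \<le> (1 - s) * r" "0 \<le> (1 - t) * r"
    "s * r \<le> t * r" "(1 - t) * r \<le> (1 - s) * r"
    using assms by (auto intro: mult_right_mono)
  have delayed: "\<Omega> (t * r) p \<le> \<Omega> ((t - s) * r) q" if "\<Omega> (s * r) p \<le> q" for p q
  proof -
    have "\<Omega> (t * r) p = \<Omega> ((t - s) * r) (\<Omega> (s * r) p)"
      using flow_add[OF \<Omega>, of "s * r" "(t - s) * r" p] le by (simp add: algebra_simps)
    then show ?thesis
      using flow_mono[OF \<Omega> le(3) that] by simp
  qed
  have advanced: "\<Omega> ((1 - s) * r) p \<le> \<Omega> ((t - s) * r) q" if "\<Omega> ((1 - t) * r) p \<le> q" for p q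
  proof -
    have "\<Omega> ((1 - s) * r) p = \<Omega> ((t - s) * r) (\<Omega> ((1 - t) * r) p)"
      using flow_add[OF \<Omega>, of "(1 - t) * r" "(t - s) * r" p] le by (simp add: algebra_simps)
    then show ?thesis
      using flow_mono[OF \<Omega> le(3) that] by simp
  qed
  have early: "\<Omega> a p \<le> \<Omega> ((t - s) * r) q" if "\<Omega> b p \<le> q" "0 \<le> a" "a \<le> b" for a b p q
    using that flow_le[OF \<Omega>] flow_expand[OF \<Omega> le(3)] by (meson order_trans)
  show ?thesis
    unfolding interleaved_def
  proof (intro allI conjI subsetI)
    fix q \<sigma>
    assume "\<sigma> \<in> interpolation \<Omega> r F G s q"
    then show "\<sigma> \<in> interpolation \<Omega> r F G t (\<Omega> ((t - s) * r) q)"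
      unfolding interpolation_iff using delayed early[OF _ le(5,7)] by blast
  next
    fix q \<sigma>
    assume "\<sigma> \<in> interpolation \<Omega> r F G t q"
    then show "\<sigma> \<in> interpolation \<Omega> r F G s (\<Omega> ((t - s) * r) q)"
      unfolding interpolation_iff using advanced early[OF _ le(1,6)] by blast
  qed
qed

text \<open>If \<open>\<sigma> \<in> G p\<close> with \<open>\<Omega> ((1 - t) * r) p \<le> q\<close>, then an interleaving of \<open>F\<close> and \<open>G\<close> by
  \<open>r + \<delta>\<close> puts \<open>\<sigma>\<close> into \<open>F\<close> at \<open>\<Omega> (r + \<delta>) p \<le> \<Omega> (t * r + \<delta>) q\<close>. The slack \<open>\<delta>\<close> accounts for infima
  that are not attained.\<close>

lemma interleaved_interpolation_left:
  assumes \<Omega>: "flow \<Omega>" and "mono F" and "0 \<le> r" "0 \<le> t" "t \<le> 1" "0 \<le> \<delta>"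
    and FG: "interleaved \<Omega> (r + \<delta>) F G"
  shows "interleaved \<Omega> (t * r + \<delta>) F (interpolation \<Omega> r F G t)"
proof -
  have le: "0 \<le> t * r" "t * r \<le> t * r + \<delta>" "0 \<le> t * r + \<delta>" "0 \<le> (1 - t) * r"
    using assms by auto
  have F: "F p \<subseteq> F (\<Omega> (t * r + \<delta>) q)" if "\<Omega> (t * r) p \<le> q" for p q
  proof -
    have "p \<le> \<Omega> (t * r + \<delta>) q"
      using that flow_expand[OF \<Omega> le(1)] flow_expand[OF \<Omega> le(3)] by (meson order_trans)
    then show ?thesis
      using \<open>mono F\<close> monoD by blast
  qed
  have G: "G p \<subseteq> F (\<Omega> (t * r + \<delta>) q)" if "\<Omega> ((1 - t) * r) p \<le> q" for p q
  proof -
    have "\<Omega> (r + \<delta>) p = \<Omega> (t * r + \<delta>) (\<Omega> ((1 - t) * r) p)"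
      using flow_add[OF \<Omega> le(4,3), of p] by (simp add: algebra_simps)
    then have "\<Omega> (r + \<delta>) p \<le> \<Omega> (t * r + \<delta>) q"
      using flow_mono[OF \<Omega> le(3) that] by simp
    then have "F (\<Omega> (r + \<delta>) p) \<subseteq> F (\<Omega> (t * r + \<delta>) q)"
      using \<open>mono F\<close> monoD by blast
    then show ?thesis
      using FG unfolding interleaved_def by blast
  qed
  show ?thesis
    unfolding interleaved_def
  proof (intro allI conjI subsetI)
    fix p \<sigma>
    assume "\<sigma> \<in> F p"
    then show "\<sigma> \<in> interpolation \<Omega> r F G t (\<Omega> (t * r + \<delta>) p)"
      unfolding interpolation_iff using flow_le[OF \<Omega> le(1,2)] by blast
  next
    fix q \<sigma>
    assume "\<sigma> \<in> interpolation \<Omega> r F G t q"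
    then show "\<sigma> \<in> F (\<Omega> (t * r + \<delta>) q)"
      unfolding interpolation_iff using F G by blast
  qed
qed

lemma interleaved_interpolation_right:
  assumes "flow \<Omega>" "mono G" "0 \<le> r" "0 \<le> t" "t \<le> 1" "0 \<le> \<delta>" "interleaved \<Omega> (r + \<delta>) F G"
  shows "interleaved \<Omega> ((1 - t) * r + \<delta>) (interpolation \<Omega> r F G t) G"
proof -
  have "interleaved \<Omega> (r + \<delta>) G F"
    using assms(7) interleaved_commute by blast
  then have "interleaved \<Omega> ((1 - t) * r + \<delta>) G (interpolation \<Omega> r G F (1 - t))"
    using assms by (intro interleaved_interpolation_left) auto
  then show ?thesis
    unfolding interpolation_swap[of \<Omega> r F G t] using interleaved_commute by blast
qed

section \<open>The interpolation as a geodesic\<close>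

lemma d_GH_le_d_I:
  assumes "filtration Z F" "filtration Z G" "finite Z" "Z \<noteq> {}"
  shows "d_GH \<Omega> (Z, F) (Z, G) \<le> d_I \<Omega> F G / 2"
proof -
  have "tripod Z Z Z id id"
    using assms(3,4) by (simp add: tripod_def)
  then show ?thesis
    using d_GH_le[of Z Z Z id id \<Omega> F G]
    unfolding pullback_id[OF assms(1,3)] pullback_id[OF assms(2,3)] by blast
qed

text \<open>Scaling distances by a finite factor is continuous, so only the metric condition on a
  geodesic and its end points have to be checked.\<close>

lemma geodesic_pathI:
  assumes M: "\<And>t. t \<in> {0..1} \<Longrightarrow> g t \<in> M" and ends: "d (g 0) x = 0" "d (g 1) y = 0"
    and d: "\<And>s t. s \<in> {0..1} \<Longrightarrow> t \<in> {0..1} \<Longrightarrow> d (g s) (g t) = ennreal \<bar>s - t\<bar> * d x y"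
    and fin: "d x y < \<infinity>"
  shows "geodesic_path M d x y g"
proof -
  have "\<exists>\<delta>>0. \<forall>t\<in>{0..1}. \<bar>t - s\<bar> < \<delta> \<longrightarrow> d (g s) (g t) < \<epsilon>"
    if s: "s \<in> {0..1}" and \<epsilon>: "0 < \<epsilon>" for s and \<epsilon> :: ennreal
  proof -
    obtain c where c: "0 \<le> c" "d x y = ennreal c"
      using fin by (cases "d x y") auto
    obtain e where e: "0 < e" "ennreal e \<le> \<epsilon>"
    proof (cases \<epsilon>)
      case (real e)
      then show ?thesis
        using \<epsilon> that[of e] by simp
    next
      case top
      then show ?thesis
        using that[of 1] by simp
    qed
    have "d (g s) (g t) < \<epsilon>" if t: "t \<in> {0..1}" "\<bar>t - s\<bar> < e / (c + 1)" for t
    proof -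
      have "\<bar>s - t\<bar> * c \<le> \<bar>t - s\<bar> * (c + 1)"
        by (simp add: abs_minus_commute mult_left_mono)
      also have "\<dots> < e"
        using t(2) c(1) by (simp add: pos_less_divide_eq)
      finally have "ennreal (\<bar>s - t\<bar> * c) < ennreal e"
        using c(1) by (intro ennreal_lessI) (auto simp: e)
      moreover have "d (g s) (g t) = ennreal (\<bar>s - t\<bar> * c)"
        using d[OF s t(1)] c by (simp add: ennreal_mult)
      ultimately show ?thesis
        using e(2) by simp
    qed
    moreover have "0 < e / (c + 1)"
      using e(1) c(1) by simp
    ultimately show ?thesis
      by blast
  qed
  then show ?thesis
    unfolding geodesic_path_def path_between_def using M ends d by auto
qed

theorem theorem4p12:
  fixes \<Omega> :: "real \<Rightarrow> 'p::order \<Rightarrow> 'p"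
  assumes "flow \<Omega>"
    and "infinite (UNIV :: 'v set)"
  shows "geodesic (filtrations :: ('v set \<times> ('p \<Rightarrow> 'v set set)) set) (d_GH \<Omega>)"
  unfolding geodesic_def
proof (intro ballI impI)
  fix x y :: "'v set \<times> ('p \<Rightarrow> 'v set set)"
  assume "x \<in> filtrations" "y \<in> filtrations" and fin: "d_GH \<Omega> x y < \<infinity>"
  then obtain X F0 Y G0 where x: "x = (X, F0)" and X: "finite X" "filtration X F0"
    and y: "y = (Y, G0)" and Y: "finite Y" "filtration Y G0"
    by (auto simp: filtrations_def)
  obtain Z :: "'v set" and \<phi> \<psi> r where T: "tripod X Y Z \<phi> \<psi>" and r: "0 \<le> r"
    and dI: "d_I \<Omega> (pullback Z \<phi> F0) (pullback Z \<psi> G0) = ennreal r"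
    and dxy: "d_GH \<Omega> x y = ennreal r / 2"
    using d_GH_attained[OF X(2,1) Y(2,1)] fin x y by metis
  define F where "F = pullback Z \<phi> F0"
  define G where "G = pullback Z \<psi> G0"
  define H where "H = interpolation \<Omega> r F G"
  have Z: "finite Z" "Z \<noteq> {}" "\<phi> ` Z = X" "\<psi> ` Z = Y"
    using T by (auto simp: tripod_def)
  have F: "filtration Z F" and G: "filtration Z G"
    unfolding F_def G_def using filtration_pullback X Y Z by blast+
  have H: "filtration Z (H t)" for t
    unfolding H_def using F G by (rule filtration_interpolation)
  have mono_FG: "mono F" "mono G"
    using F G by (auto simp: filtration_def)
  have FG: "interleaved \<Omega> (r + \<delta>) F G" if "0 < \<delta>" for \<delta>
    using interleaved_if_d_I_less[OF assms(1) mono_FG] dI that r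
    unfolding F_def G_def by (simp add: ennreal_less_iff)
  have FH: "interleaved \<Omega> (t * r + \<delta>) F (H t)" if "t \<in> {0..1}" "0 < \<delta>" for t \<delta>
    unfolding H_def using interleaved_interpolation_left[OF assms(1) mono_FG(1) r] FG that by auto
  have HG: "interleaved \<Omega> ((1 - t) * r + \<delta>) (H t) G" if "t \<in> {0..1}" "0 < \<delta>" for t \<delta>
    unfolding H_def using interleaved_interpolation_right[OF assms(1) mono_FG(2) r] FG that by auto

  have "d_I \<Omega> (H 0) F = 0" "d_I \<Omega> (H 1) G = 0"
    using FH[of 0] HG[of 1] by (auto intro!: d_I_eq_0 simp: interleaved_commute)
  \<comment> \<open>In these tripods \<open>H 0\<close> and \<open>H 1\<close> stay as they are, while the ends pull back to \<open>F\<close> and \<open>G\<close>.\<close>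
  moreover have "tripod Z X Z id \<phi>" "tripod Z Y Z id \<psi>"
    using Z by (auto simp: tripod_def)
  ultimately have ends: "d_GH \<Omega> (Z, H 0) x = 0" "d_GH \<Omega> (Z, H 1) y = 0"
    using d_GH_le[of Z X Z id \<phi> \<Omega> "H 0" F0] d_GH_le[of Z Y Z id \<psi> \<Omega> "H 1" G0]
    by (simp_all add: x y pullback_id[OF H Z(1)] F_def G_def)

  have ordered: "d_GH \<Omega> (Z, H s) (Z, H t) = ennreal ((t - s) * r) / 2"
    if st: "s \<in> {0..1}" "t \<in> {0..1}" "s \<le> t" for s t
  proof (rule antisym)
    have "interleaved \<Omega> ((t - s) * r) (H s) (H t)"
      unfolding H_def using interleaved_interpolation[OF assms(1) r] st by auto
    then have "d_I \<Omega> (H s) (H t) \<le> ennreal ((t - s) * r)"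
      using st(3) r by (intro d_I_le mult_nonneg_nonneg) auto
    then show "d_GH \<Omega> (Z, H s) (Z, H t) \<le> ennreal ((t - s) * r) / 2"
      using d_GH_le_d_I[OF H H Z(1,2)] divide_right_mono_ennreal order_trans by blast
  next
    show "ennreal ((t - s) * r) / 2 \<le> d_GH \<Omega> (Z, H s) (Z, H t)"
    proof (intro le_d_GH le_d_I ennreal_leI)
      fix W :: "'v set" and \<alpha> \<beta> \<epsilon>
      assume W: "tripod Z Z W \<alpha> \<beta>" and \<epsilon>: "0 \<le> \<epsilon>"
        and st_int: "interleaved \<Omega> \<epsilon> (pullback W \<alpha> (H s)) (pullback W \<beta> (H t))"
      then have W': "finite W" "\<alpha> ` W = Z" "\<beta> ` W = Z"
        by (auto simp: tripod_def)
      show "(t - s) * r \<le> \<epsilon>"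
      proof (rule field_le_epsilon)
        fix \<eta> :: real
        assume "0 < \<eta>"
        \<comment> \<open>One half of the slack is spent between \<open>F\<close> and \<open>H s\<close>, the other between \<open>H t\<close> and \<open>G\<close>.\<close>
        define \<delta> where "\<delta> = \<eta> / 2"
        have \<delta>: "0 < \<delta>"
          using \<open>0 < \<eta>\<close> by (simp add: \<delta>_def)
        have nonneg: "0 \<le> s * r + \<delta>" "0 \<le> (1 - t) * r + \<delta>"
          using st r \<delta> by (simp_all add: add_nonneg_pos less_imp_le)
        have "interleaved \<Omega> (s * r + \<delta>) (pullback W \<alpha> F) (pullback W \<alpha> (H s))"
          using interleaved_pullback[OF F H W'(1,2)] FH st \<delta> by blast
        moreover have "interleaved \<Omega> ((1 - t) * r + \<delta>) (pullback W \<beta> (H t)) (pullback W \<beta> G)"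
          using interleaved_pullback[OF H G W'(1,3)] HG st \<delta> by blast
        ultimately have "interleaved \<Omega> (s * r + \<delta> + \<epsilon> + ((1 - t) * r + \<delta>))
            (pullback W \<alpha> F) (pullback W \<beta> G)"
          using st_int nonneg \<epsilon> by (meson add_nonneg_nonneg assms(1) interleaved_trans)
        moreover have "pullback W \<alpha> F = pullback W (\<phi> \<circ> \<alpha>) F0"
          "pullback W \<beta> G = pullback W (\<psi> \<circ> \<beta>) G0"
          unfolding F_def G_def using pullback_comp X Y Z W' by blast+
        moreover have "tripod X Y W (\<phi> \<circ> \<alpha>) (\<psi> \<circ> \<beta>)"
          using W Z unfolding tripod_def by (metis image_comp)
        ultimately have "d_GH \<Omega> x y \<le> ennreal (s * r + \<delta> + \<epsilon> + ((1 - t) * r + \<delta>)) / 2"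
          unfolding x y using nonneg \<epsilon>
          by (intro order_trans[OF d_GH_le] divide_right_mono_ennreal d_I_le) auto
        then have "ennreal r / ennreal 2 \<le> ennreal (s * r + \<delta> + \<epsilon> + ((1 - t) * r + \<delta>)) / ennreal 2"
          by (simp add: dxy)
        then have "r / 2 \<le> (s * r + \<delta> + \<epsilon> + ((1 - t) * r + \<delta>)) / 2"
          using r nonneg \<epsilon> by (subst (asm) (1 2) divide_ennreal) auto
        then show "(t - s) * r \<le> \<epsilon> + \<eta>"
          by (simp add: \<delta>_def algebra_simps)
      qed
    qed
  qed
  have dist: "d_GH \<Omega> (Z, H s) (Z, H t) = ennreal \<bar>s - t\<bar> * d_GH \<Omega> x y"
    if "s \<in> {0..1}" "t \<in> {0..1}" for s t
  proof -
    have "d_GH \<Omega> (Z, H s) (Z, H t) = ennreal (\<bar>s - t\<bar> * r) / 2"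
    proof (cases "s \<le> t")
      case True
      then show ?thesis
        using ordered that by simp
    next
      case False
      then show ?thesis
        using ordered[of t s] that d_GH_commute[of \<Omega> Z "H s"] by simp
    qed
    then show ?thesis
      using r by (simp add: dxy ennreal_mult ennreal_times_divide)
  qed

  have "geodesic_path filtrations (d_GH \<Omega>) x y (\<lambda>t. (Z, H t))"
    using Z H by (intro geodesic_pathI ends dist fin) (auto simp: filtrations_def)
  then show "\<exists>g. geodesic_path filtrations (d_GH \<Omega>) x y g"
    by blast
qed

end
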